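(* Let $x_0\sim\mu$ and let $(x_0,x_1,\dots,x_\sigma)$ be the nonreactive trajectory of the first passage path $(x_0,\dots,x_{\tau_B})$ of the Markov chain with transition probabilities $p$. Let $(y_k)_{k\ge 0}$ be the Markov chain on $V^-\cup\{0\}$ with initial distribution $\mu$ (on $A\subseteq V^-$) and transition probabilities $\bar p$ given, for $y\in V^-$ and $x\in V^-\cup\{0\}$, by $$\bar p(x\,|\,y)=\begin{cases}\dfrac{p(x\,|\,y)\,(1-q(x))}{1-q(y)}, & x\neq 0,\\[2mm] \sum_{z\in V}p(z\,|\,y)\,q(z), & x=0,\ y\in A,\\ 0, & x=0,\ y\notin A,\end{cases}$$ and $\bar p(x\,|\,0)=\delta(x)$ (i.e. the virtual node $0$ is absorbing). Then the ensemble of nonreactive trajectories is generated by the trajectories of $(y_k)$ without the end node $0$; that is, the random finite sequence $(x_0,\dots,x_\sigma)$ has the same law as $(y_0,\dots,y_{\zeta-1})$, where $\zeta=\min\{k\ge 0: y_k=0\}$.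
   Context: $V=\{1,\dots,n\}$ with $n>1$; $p(y\,|\,x)$, $x,y\in V$, is the probability that a discrete-time Markov chain $(x_k)_{k\ge0}$ on $V$ jumps from $x$ to $y$ (so $\sum_{y}p(y\,|\,x)=1$). $A,B\subset V$ are disjoint and nonempty, complements are taken in $V$, and $\mu$ is a probability distribution on $A$. For $x\in V$, a set $A$ (resp. $B$) is reachable from $x$ if there is a finite path $x_0=x,x_1,\dots,x_k$, $k\ge0$, with $x_k\in A$ (resp. $x_k\in B$), $x_l\in(A\cup B)^c$ for $1\le l\le k-1$, and $p(x_{l+1}\,|\,x_l)>0$ for $0\le l\le k-1$. Standing assumption: $(A\cup B)^c\ne\emptyset$; from each $x\in(A\cup B)^c$ either $A$ or $B$ is reachable; and $B$ is reachable from each $x\in A$. $\tau_A=\min\{k\ge0:x_k\in A\}$, $\tau_B=\min\{k\ge 0:x_k\in B\}$ ($+\infty$ if never reached), with subscript $x$ when $x_0=x$. Committor: $q(x)=\mathbb P(\tau_{B,x}<\tau_{A,x})$, $x\in V$. A first passage path is $(x_0,\dots,x_{\tau_B})$ with $x_0\in B^c$. For $x_0\in A$, the last hitting time of $A$ is $\sigma=\max\{l: x_l\in A,\ 0\le l<\tau_B\}$; the nonreactive trajectory is $(x_0,\dots,x_\sigma)$. $V^-=\{x\in V: q(x)<1\}$. The symbol $0$ denotes an extra virtual node not in $V$ marking the end of the path. *)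

theory Defs
  imports "HOL-Probability.Probability"
begin

text \<open>
  States are natural numbers; in the theorem the state space of the chain is
  \<open>V = {1..n}\<close>, so the number \<open>0\<close> is available as the virtual end node outside \<open>V\<close>.
  Transition probabilities are written in the order \<open>p y x\<close>, standing for \<open>p(y | x)\<close>,
  the probability of a jump from \<open>x\<close> to \<open>y\<close>.
\<close>

definition transition_matrix :: "nat set \<Rightarrow> (nat \<Rightarrow> nat \<Rightarrow> real) \<Rightarrow> bool" where
  "transition_matrix S p \<longleftrightarrow>
     (\<forall>x\<in>S. (\<forall>y\<in>S. 0 \<le> p y x) \<and> (\<Sum>y\<in>S. p y x) = 1)"

text \<open>
  The chain may live on any probability space. Conditions involving \<open>p\<close> are imposed only
  for histories of positive probability.
\<close>

definition markov_chain ::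
    "'w measure \<Rightarrow> nat set \<Rightarrow> nat pmf \<Rightarrow> (nat \<Rightarrow> nat \<Rightarrow> real) \<Rightarrow> (nat \<Rightarrow> 'w \<Rightarrow> nat) \<Rightarrow> bool" where
  "markov_chain M S \<mu> p X \<longleftrightarrow>
     prob_space M \<and>
     (\<forall>k. X k \<in> measurable M (count_space S)) \<and>
     (\<forall>s\<in>S. \<P>(w in M. X 0 w = s) = pmf \<mu> s) \<and>
     (\<forall>k h. \<forall>s\<in>S.
        \<P>(w in M. \<forall>i\<le>k. X i w = h i) > 0 \<longrightarrow>
        \<P>(w in M. X (Suc k) w = s \<bar> \<forall>i\<le>k. X i w = h i) = p s (h k))"

definition reachable ::
    "nat set \<Rightarrow> (nat \<Rightarrow> nat \<Rightarrow> real) \<Rightarrow> nat set \<Rightarrow> nat set \<Rightarrow> nat set \<Rightarrow> nat \<Rightarrow> bool" where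
  "reachable V p A B C x \<longleftrightarrow>
     (\<exists>k v. v 0 = x \<and> v k \<in> C \<and> (\<forall>l\<le>k. v l \<in> V) \<and>
            (\<forall>l. 1 \<le> l \<and> l < k \<longrightarrow> v l \<in> V - (A \<union> B)) \<and>
            (\<forall>l<k. p (v (Suc l)) (v l) > 0))"

definition hitting_time :: "nat set \<Rightarrow> (nat \<Rightarrow> nat) \<Rightarrow> enat" where
  "hitting_time C x = (INF k\<in>{k. x k \<in> C}. enat k)"

text \<open>
  \<open>Z x\<close> is a chain started at \<open>x\<close>, realised on the probability space \<open>K x\<close>.
\<close>

definition committor ::
    "(nat \<Rightarrow> 'w measure) \<Rightarrow> (nat \<Rightarrow> nat \<Rightarrow> 'w \<Rightarrow> nat) \<Rightarrow> nat set \<Rightarrow> nat set \<Rightarrow> nat \<Rightarrow> real" where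
  "committor K Z A B x =
     \<P>(w in K x. hitting_time B (\<lambda>k. Z x k w) < hitting_time A (\<lambda>k. Z x k w))"

definition V_minus :: "nat set \<Rightarrow> (nat \<Rightarrow> real) \<Rightarrow> nat set" where
  "V_minus V q = {x \<in> V. q x < 1}"

definition last_hit :: "nat set \<Rightarrow> nat set \<Rightarrow> (nat \<Rightarrow> nat) \<Rightarrow> nat" where
  "last_hit A B x = Max {l. x l \<in> A \<and> enat l < hitting_time B x}"

text \<open>
  Meaningful when the path starts in \<open>A\<close> and hits \<open>B\<close> in finite time
  (otherwise \<open>Max\<close> may be taken of an empty or infinite set).
\<close>

definition nonreactive :: "nat set \<Rightarrow> nat set \<Rightarrow> (nat \<Rightarrow> nat) \<Rightarrow> nat list" where
  "nonreactive A B x = map x [0..<Suc (last_hit A B x)]"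

definition pbar ::
    "nat set \<Rightarrow> nat set \<Rightarrow> (nat \<Rightarrow> nat \<Rightarrow> real) \<Rightarrow> (nat \<Rightarrow> real) \<Rightarrow> nat \<Rightarrow> nat \<Rightarrow> real" where
  "pbar V A p q x y =
     (if y = 0 then (if x = 0 then 1 else 0)
      else if x \<noteq> 0 then p x y * (1 - q x) / (1 - q y)
      else if y \<in> A then (\<Sum>z\<in>V. p z y * q z)
      else 0)"

text \<open>Meaningful when the path reaches the node \<open>0\<close> in finite time.\<close>

definition before_end :: "(nat \<Rightarrow> nat) \<Rightarrow> nat list" where
  "before_end y = map y [0..<the_enat (hitting_time {0} y)]"

end

theory Submission
  imports Defs
begin

text \<open>
  Decomposing according to the first entrance into \<open>B\<close>, a list \<open>x\<^sub>0, \<dots>, x\<^sub>m\<close> that avoids \<open>B\<close> and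
  ends in \<open>A\<close> is the nonreactive trajectory with probability
  \<open>\<mu>(x\<^sub>0) \<cdot> \<Prod> p(x\<^sub>i\<^sub>+\<^sub>1 | x\<^sub>i) \<cdot> \<Sum>\<^sub>z p(z | x\<^sub>m) q(z)\<close>.
  In the corresponding product for \<open>pbar\<close> the Doob factors telescope to \<open>(1 - q(x\<^sub>m)) / (1 - q(x\<^sub>0)) = 1\<close>,
  because \<open>q = 0\<close> on \<open>A\<close>, so the weights agree; lists leaving \<open>V_minus\<close> have weight zero since a chain
  sitting at \<open>q = 1\<close> cannot return to \<open>A\<close> before \<open>B\<close>. The weights sum to one because \<open>B\<close> is hit
  almost surely; hence the chain \<open>Y\<close> reaches the end node almost surely, which needs no argument of its own.
\<close>

section \<open>Hitting times\<close>

text \<open>Against a finite time, strict inequality means \<open>enat (Suc l) \<le>\<close> an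
  infimum, which unfolds pointwise; a path that never hits \<open>C\<close> has infimum infinity and
  is covered too.\<close>

lemma less_hitting_time_iff:
  "enat l < hitting_time C x \<longleftrightarrow> (\<forall>j\<le>l. x j \<notin> C)"
proof -
  have "enat l < hitting_time C x \<longleftrightarrow> enat (Suc l) \<le> hitting_time C x"
    by (simp add: Suc_ile_eq)
  also have "\<dots> \<longleftrightarrow> (\<forall>k. x k \<in> C \<longrightarrow> l < k)"
    by (auto simp: hitting_time_def le_INF_iff)
  also have "\<dots> \<longleftrightarrow> (\<forall>j\<le>l. x j \<notin> C)"
    by (meson leD leI)
  finally show ?thesis .
qed

lemma hitting_time_Least:
  assumes "x k \<in> C"
  shows "hitting_time C x = enat (LEAST k. x k \<in> C)"
  unfolding hitting_time_def
proof (rule antisym)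
  show "(INF k\<in>{k. x k \<in> C}. enat k) \<le> enat (LEAST k. x k \<in> C)"
    using LeastI[of "\<lambda>k. x k \<in> C", OF assms] by (intro INF_lower) simp
  show "enat (LEAST k. x k \<in> C) \<le> (INF k\<in>{k. x k \<in> C}. enat k)"
    by (intro INF_greatest) (simp add: Least_le)
qed

lemma hitting_time_infinity: "(\<And>k. x k \<notin> C) \<Longrightarrow> hitting_time C x = \<infinity>"
  by (simp add: hitting_time_def top_enat_def)

lemma hitting_time_finite_iff: "hitting_time C x < \<infinity> \<longleftrightarrow> (\<exists>k. x k \<in> C)"
  using hitting_time_Least[of x _ C] hitting_time_infinity[of x C] by fastforce

lemma hitting_time_eq_enat_iff:
  "hitting_time C x = enat m \<longleftrightarrow> x m \<in> C \<and> (\<forall>j<m. x j \<notin> C)"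
proof
  assume h: "hitting_time C x = enat m"
  then obtain k where "x k \<in> C"
    using hitting_time_infinity[of x C] by fastforce
  with h have "(LEAST k. x k \<in> C) = m"
    by (simp add: hitting_time_Least)
  with \<open>x k \<in> C\<close> show "x m \<in> C \<and> (\<forall>j<m. x j \<notin> C)"
    by (metis LeastI not_less_Least)
next
  assume "x m \<in> C \<and> (\<forall>j<m. x j \<notin> C)"
  then show "hitting_time C x = enat m"
    by (subst hitting_time_Least[of x m]) (auto intro!: Least_equality leI)
qed

text \<open>Prepares the committor event as a union, over the entrance time \<open>k\<close>, of
  events on finitely many coordinates. Disjointness of \<open>A\<close> and \<open>B\<close>
  excludes \<open>A\<close> at time \<open>k\<close> itself.\<close>

lemma hitting_time_less_iff:
  assumes "A \<inter> B = {}" and "\<And>k. x k \<in> V"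
  shows "hitting_time B x < hitting_time A x \<longleftrightarrow>
    (\<exists>k. (\<forall>j<k. x j \<in> V - (A \<union> B)) \<and> x k \<in> B)"
proof
  assume less: "hitting_time B x < hitting_time A x"
  then obtain m where m: "hitting_time B x = enat m"
    by (cases "hitting_time B x") auto
  with less have "\<forall>j\<le>m. x j \<notin> A"
    by (simp add: less_hitting_time_iff)
  with m show "\<exists>k. (\<forall>j<k. x j \<in> V - (A \<union> B)) \<and> x k \<in> B"
    using assms(2) by (intro exI[of _ m]) (auto simp: hitting_time_eq_enat_iff)
next
  assume "\<exists>k. (\<forall>j<k. x j \<in> V - (A \<union> B)) \<and> x k \<in> B"
  then obtain k where k: "\<forall>j<k. x j \<in> V - (A \<union> B)" "x k \<in> B" by blast
  then have "hitting_time B x = enat k"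
    by (auto simp: hitting_time_eq_enat_iff)
  moreover have "\<forall>j\<le>k. x j \<notin> A"
    using k assms(1) by (auto simp: le_less)
  ultimately show "hitting_time B x < hitting_time A x"
    by (simp add: less_hitting_time_iff)
qed

section \<open>Finite Markov chains\<close>

text \<open>First-step recursion for the probability, from \<open>x\<close>, of being in
  \<open>D\<close> at all times below \<open>k\<close> and in \<open>E\<close> at time
  \<open>k\<close>. With \<open>E = S\<close> it is a survival probability; with \<open>D\<close>
  the complement of \<open>A \<union> B\<close> and \<open>E = B\<close> it is a term of the
  committor series.\<close>

primrec path_prob ::
    "nat set \<Rightarrow> (nat \<Rightarrow> nat \<Rightarrow> real) \<Rightarrow> nat set \<Rightarrow> nat set \<Rightarrow> nat \<Rightarrow> nat \<Rightarrow> real" where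
  "path_prob S p D E 0 x = indicator E x"
| "path_prob S p D E (Suc k) x = indicator D x * (\<Sum>y\<in>S. p y x * path_prob S p D E k y)"

locale finite_markov_chain =
  fixes M :: "'w measure" and S :: "nat set" and \<mu> :: "nat pmf"
    and p :: "nat \<Rightarrow> nat \<Rightarrow> real" and X :: "nat \<Rightarrow> 'w \<Rightarrow> nat"
  assumes markov: "markov_chain M S \<mu> p X" and finite_states: "finite S"
begin

sublocale prob_space M
  using markov by (simp add: markov_chain_def)

lemma measurable_X [measurable]: "X k \<in> measurable M (count_space UNIV)"
proof (rule measurable_compose[of "X k" M "count_space S" "\<lambda>x. x"])
  show "X k \<in> measurable M (count_space S)"
    using markov by (simp add: markov_chain_def)
qed simp

lemma X_in_states: "w \<in> space M \<Longrightarrow> X k w \<in> S"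
  using markov measurable_space[of "X k" M "count_space S" w] by (simp add: markov_chain_def)

text \<open>Multiplying out the conditional probability removes the proviso of positive probability:
  for a null history both sides vanish.\<close>

lemma prob_step:
  assumes s: "s \<in> S"
  shows "\<P>(w in M. (\<forall>i\<le>k. X i w = h i) \<and> X (Suc k) w = s) =
    \<P>(w in M. \<forall>i\<le>k. X i w = h i) * p s (h k)"
proof (cases "\<P>(w in M. \<forall>i\<le>k. X i w = h i) > 0")
  case True
  then have "\<P>(w in M. X (Suc k) w = s \<bar> \<forall>i\<le>k. X i w = h i) = p s (h k)"
    using markov s by (simp add: markov_chain_def)
  with True show ?thesis
    by (simp add: cond_prob_def field_simps conj_commute)
next
  case False
  then have zero: "\<P>(w in M. \<forall>i\<le>k. X i w = h i) = 0"
    by (simp add: zero_less_measure_iff)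
  have "\<P>(w in M. (\<forall>i\<le>k. X i w = h i) \<and> X (Suc k) w = s) \<le> \<P>(w in M. \<forall>i\<le>k. X i w = h i)"
    by (rule finite_measure_mono) auto
  with zero show ?thesis
    by (simp add: measure_le_0_iff)
qed

lemma prob_history:
  assumes "\<And>i. i \<le> k \<Longrightarrow> h i \<in> S"
  shows "\<P>(w in M. \<forall>i\<le>k. X i w = h i) = pmf \<mu> (h 0) * (\<Prod>i<k. p (h (Suc i)) (h i))"
  using assms
proof (induction k)
  case 0
  then show ?case using markov by (simp add: markov_chain_def)
next
  case (Suc k)
  have "\<P>(w in M. \<forall>i\<le>Suc k. X i w = h i) =
      \<P>(w in M. (\<forall>i\<le>k. X i w = h i) \<and> X (Suc k) w = h (Suc k))"
    by (rule arg_cong[where f = "measure M"]) (auto simp: le_Suc_eq)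
  then show ?case using Suc by (simp add: prob_step)
qed

lemma prob_history_Suc:
  assumes "y \<in> S"
  shows "\<P>(w in M. \<forall>i\<le>Suc m. X i w = (h(Suc m := y)) i) =
    \<P>(w in M. \<forall>i\<le>m. X i w = h i) * p y (h m)"
proof -
  have "\<P>(w in M. \<forall>i\<le>Suc m. X i w = (h(Suc m := y)) i) =
      \<P>(w in M. (\<forall>i\<le>m. X i w = h i) \<and> X (Suc m) w = y)"
    by (rule arg_cong[where f = "measure M"]) (auto simp: le_Suc_eq)
  with assms show ?thesis by (simp add: prob_step)
qed

text \<open>Splits by the state at time \<open>Suc m\<close>. Writing the longer history as an
  updated function keeps its form, so that the splitting fits into inductions over
  histories.\<close>

lemma prob_history_extend:
  assumes [measurable]: "Measurable.pred M P"
  shows "\<P>(w in M. (\<forall>i\<le>m. X i w = h i) \<and> P w) =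
    (\<Sum>y\<in>S. \<P>(w in M. (\<forall>i\<le>Suc m. X i w = (h(Suc m := y)) i) \<and> P w))"
proof -
  have "{w \<in> space M. (\<forall>i\<le>m. X i w = h i) \<and> P w} =
      (\<Union>y\<in>S. {w \<in> space M. (\<forall>i\<le>Suc m. X i w = (h(Suc m := y)) i) \<and> P w})"
    using X_in_states by (auto simp: le_Suc_eq)
  then show ?thesis
    by (simp only:) (rule finite_measure_finite_Union,
      use finite_states in \<open>auto simp: disjoint_family_on_def\<close>)
qed

text \<open>The Markov property at time \<open>m\<close>. Each step of the induction moves one
  future coordinate into the history, so \<open>m\<close> and \<open>h\<close> must vary.\<close>

lemma prob_path:
  assumes "\<And>i. i \<le> m \<Longrightarrow> h i \<in> S"
  shows "\<P>(w in M. (\<forall>i\<le>m. X i w = h i) \<and> (\<forall>j<k. X (m + j) w \<in> D) \<and> X (m + k) w \<in> E) =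
    \<P>(w in M. \<forall>i\<le>m. X i w = h i) * path_prob S p D E k (h m)"
  using assms
proof (induction k arbitrary: m h)
  case 0
  have "{w \<in> space M. (\<forall>i\<le>m. X i w = h i) \<and> X m w \<in> E} =
      (if h m \<in> E then {w \<in> space M. \<forall>i\<le>m. X i w = h i} else {})"
    by auto
  then show ?case by (auto split: if_splits)
next
  case (Suc k)
  show ?case
  proof (cases "h m \<in> D")
    case False
    \<comment> \<open>At \<open>j = 0\<close> the event demands that \<open>h m\<close> lie in
      \<open>D\<close>.\<close>
    then have "{w \<in> space M. (\<forall>i\<le>m. X i w = h i) \<and> (\<forall>j<Suc k. X (m + j) w \<in> D) \<and>
        X (m + Suc k) w \<in> E} = {}"
      by force
    with False show ?thesis by (simp only: measure_empty) simp
  next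
    case True
    let ?H = "\<lambda>y. h(Suc m := y)"
    have "\<P>(w in M. (\<forall>i\<le>m. X i w = h i) \<and> (\<forall>j<Suc k. X (m + j) w \<in> D) \<and>
          X (m + Suc k) w \<in> E) =
        \<P>(w in M. (\<forall>i\<le>m. X i w = h i) \<and> (\<forall>j<k. X (Suc m + j) w \<in> D) \<and>
          X (Suc m + k) w \<in> E)"
      using True by (intro arg_cong[where f = "measure M"])
        (auto simp: All_less_Suc2)
    also have "\<dots> = (\<Sum>y\<in>S. \<P>(w in M. (\<forall>i\<le>Suc m. X i w = ?H y i) \<and>
        (\<forall>j<k. X (Suc m + j) w \<in> D) \<and> X (Suc m + k) w \<in> E))"
      by (rule prob_history_extend) measurable
    also have "\<dots> = (\<Sum>y\<in>S. \<P>(w in M. \<forall>i\<le>Suc m. X i w = ?H y i) * path_prob S p D E k y)"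
    proof (rule sum.cong)
      fix y assume "y \<in> S"
      then have "?H y i \<in> S" if "i \<le> Suc m" for i
        using Suc.prems that \<open>y \<in> S\<close> by (auto simp: le_Suc_eq)
      from Suc.IH[of "Suc m" "?H y", OF this] show "\<P>(w in M. (\<forall>i\<le>Suc m. X i w = ?H y i) \<and>
          (\<forall>j<k. X (Suc m + j) w \<in> D) \<and> X (Suc m + k) w \<in> E) =
          \<P>(w in M. \<forall>i\<le>Suc m. X i w = ?H y i) * path_prob S p D E k y"
        by (simp only: fun_upd_same)
    qed simp
    also have "\<dots> = (\<Sum>y\<in>S. \<P>(w in M. \<forall>i\<le>m. X i w = h i) * p y (h m) * path_prob S p D E k y)"
      by (rule sum.cong) (simp_all only: prob_history_Suc)
    finally show ?thesis
      using True by (simp add: sum_distrib_left mult.assoc)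
  qed
qed

lemma prob_start: "s \<in> S \<Longrightarrow> \<P>(w in M. X 0 w = s) = pmf \<mu> s"
  using markov by (simp add: markov_chain_def)

text \<open>First-entrance decomposition: since \<open>D\<close> and \<open>E\<close> are disjoint,
  the entrance time \<open>k\<close> is unique and the events add up.\<close>

lemma sums_prob_hit:
  assumes h: "\<And>i. i \<le> m \<Longrightarrow> h i \<in> S" and "D \<inter> E = {}"
  shows "(\<lambda>k. \<P>(w in M. \<forall>i\<le>m. X i w = h i) * path_prob S p D E k (h m)) sums
    \<P>(w in M. (\<forall>i\<le>m. X i w = h i) \<and> (\<exists>k. (\<forall>j<k. X (m + j) w \<in> D) \<and> X (m + k) w \<in> E))"
proof -
  let ?F = "\<lambda>k. {w \<in> space M. (\<forall>i\<le>m. X i w = h i) \<and> (\<forall>j<k. X (m + j) w \<in> D) \<and> X (m + k) w \<in> E}"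
  have "disjoint_family ?F"
    unfolding disjoint_family_on_def
  proof (intro ballI impI)
    fix k l :: nat assume "k \<noteq> l"
    then show "?F k \<inter> ?F l = {}"
      using assms(2) by (cases "k < l") (auto simp: not_less le_less)
  qed
  then have "(\<lambda>k. measure M (?F k)) sums measure M (\<Union>k. ?F k)"
    by (intro finite_measure_UNION) auto
  moreover have "(\<Union>k. ?F k) = {w \<in> space M. (\<forall>i\<le>m. X i w = h i) \<and>
      (\<exists>k. (\<forall>j<k. X (m + j) w \<in> D) \<and> X (m + k) w \<in> E)}"
    by auto
  ultimately show ?thesis
    by (simp add: prob_path[OF h])
qed

end

section \<open>Hitting probabilities and the committor as series\<close>

context finite_markov_chain
begin

lemma sums_prob_hit_from_state:
  assumes "\<mu> = return_pmf x" "x \<in> S" "D \<inter> E = {}"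
  shows "(\<lambda>k. path_prob S p D E k x) sums \<P>(w in M. \<exists>k. (\<forall>j<k. X j w \<in> D) \<and> X k w \<in> E)"
proof -
  have start: "\<P>(w in M. X 0 w = x) = 1"
    using assms by (simp add: prob_start)
  then have "AE w in M. X 0 w = x"
    by (simp add: prob_Collect_eq_1)
  then have "\<P>(w in M. X 0 w = x \<and> (\<exists>k. (\<forall>j<k. X j w \<in> D) \<and> X k w \<in> E)) =
      \<P>(w in M. \<exists>k. (\<forall>j<k. X j w \<in> D) \<and> X k w \<in> E)"
    by (intro finite_measure_eq_AE) auto
  with sums_prob_hit[of 0 "\<lambda>_. x" D E] assms start show ?thesis
    by simp
qed

text \<open>The series involves only \<open>p\<close>, so the committor does not depend on the space
  on which the chain is realised.\<close>

lemma committor_sums: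
  assumes "\<mu> = return_pmf x" "x \<in> S" "A \<inter> B = {}"
  shows "(\<lambda>k. path_prob S p (S - (A \<union> B)) B k x) sums
    \<P>(w in M. hitting_time B (\<lambda>k. X k w) < hitting_time A (\<lambda>k. X k w))"
proof -
  have "{w \<in> space M. hitting_time B (\<lambda>k. X k w) < hitting_time A (\<lambda>k. X k w)} =
      {w \<in> space M. \<exists>k. (\<forall>j<k. X j w \<in> S - (A \<union> B)) \<and> X k w \<in> B}"
    by (intro Collect_cong conj_cong refl hitting_time_less_iff[OF assms(3)] X_in_states)
  moreover have "(S - (A \<union> B)) \<inter> B = {}" by auto
  ultimately show ?thesis
    by (simp only:) (rule sums_prob_hit_from_state[OF assms(1,2)])
qed

end

text \<open>The term of index 0 vanishes because \<open>x\<close> is outside \<open>E\<close>; the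
  shifted series is the \<open>p\<close>-average of the series at the successors.\<close>

lemma hitting_prob_harmonic:
  assumes sums: "\<And>x. x \<in> S \<Longrightarrow> (\<lambda>k. path_prob S p D E k x) sums q x"
    and x: "x \<in> S" "x \<in> D" "x \<notin> E"
  shows "q x = (\<Sum>y\<in>S. p y x * q y)"
proof -
  have "(\<lambda>k. path_prob S p D E (Suc k) x) sums (\<Sum>y\<in>S. p y x * q y)"
    using x by (auto intro!: sums_sum sums_mult sums)
  then have "(\<lambda>k. path_prob S p D E k x) sums (\<Sum>y\<in>S. p y x * q y)"
    using x by (subst (asm) sums_Suc_iff) simp
  with sums[OF x(1)] show ?thesis
    by (rule sums_unique2)
qed

text \<open>Every term of positive index carries the factor \<open>indicator D x\<close>, so only
  the term of index 0 survives. This yields the boundary values of the committor.\<close>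

lemma hitting_prob_outside:
  assumes "(\<lambda>k. path_prob S p D E k x) sums c" "x \<notin> D"
  shows "c = indicator E x"
proof -
  have "(\<lambda>k. path_prob S p D E k x) sums (\<Sum>k<1. path_prob S p D E k x)"
    using assms(2) by (intro sums_finite) (auto simp: gr0_conv_Suc Suc_le_eq not_less_eq)
  with assms(1) have "c = (\<Sum>k<1. path_prob S p D E k x)"
    by (rule sums_unique2)
  then show ?thesis by simp
qed

section \<open>Positivity and monotonicity of path probabilities\<close>

lemma path_prob_nonneg:
  assumes "transition_matrix S p" "x \<in> S"
  shows "0 \<le> path_prob S p D E k x"
  using assms(2)
proof (induction k arbitrary: x)
  case (Suc k)
  with assms(1) show ?case
    by (auto simp: transition_matrix_def intro!: mult_nonneg_nonneg sum_nonneg)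
qed simp

text \<open>The transition probabilities sum to one, so the first step gives
  \<open>indicator D x \<le> 1\<close>; averaging with nonnegative weights preserves the inequality
  afterwards.\<close>

lemma survival_prob_decreasing:
  assumes "transition_matrix S p" "x \<in> S"
  shows "path_prob S p D S (Suc k) x \<le> path_prob S p D S k x"
  using assms(2)
proof (induction k arbitrary: x)
  case 0
  then show ?case
    using assms(1) by (auto simp: transition_matrix_def indicator_def)
next
  case (Suc k)
  have "(\<Sum>y\<in>S. p y x * path_prob S p D S (Suc k) y) \<le> (\<Sum>y\<in>S. p y x * path_prob S p D S k y)"
    using Suc assms(1) by (intro sum_mono mult_left_mono) (auto simp: transition_matrix_def)
  then show ?case
    by (subst (1 2) path_prob.simps(2)) (simp add: mult_left_mono del: path_prob.simps)
qed

section \<open>Almost sure hitting\<close>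

definition transition :: "nat set \<Rightarrow> (nat \<Rightarrow> nat \<Rightarrow> real) \<Rightarrow> nat \<Rightarrow> nat \<Rightarrow> bool" where
  "transition S p x y \<longleftrightarrow> x \<in> S \<and> y \<in> S \<and> p y x > 0"

text \<open>
  The limit of the survival probabilities vanishes on \<open>B\<close> and is harmonic elsewhere, so the set
  where it attains a positive maximum would be closed under transitions and could not lead to \<open>B\<close>.
\<close>

lemma survival_prob_tendsto_0:
  assumes tm: "transition_matrix S p" and fin: "finite S"
    and reach: "\<And>x. x \<in> S \<Longrightarrow> \<exists>b\<in>B. (transition S p)\<^sup>*\<^sup>* x b"
    and x: "x \<in> S"
  shows "(\<lambda>k. path_prob S p (S - B) S k x) \<longlonglongrightarrow> 0"
proof -
  let ?u = "path_prob S p (S - B) S"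
  have "\<exists>L. (\<lambda>k. ?u k y) \<longlonglongrightarrow> L" if "y \<in> S" for y
  proof -
    have "decseq (\<lambda>k. ?u k y)"
      using survival_prob_decreasing[OF tm that] by (intro decseq_SucI)
    then show ?thesis
      using decseq_convergent[of _ 0] path_prob_nonneg[OF tm that] by metis
  qed
  then obtain L where L: "(\<lambda>k. ?u k y) \<longlonglongrightarrow> L y" if "y \<in> S" for y
    by metis
  have L_B: "L y = 0" if "y \<in> S" "y \<in> B" for y
  proof -
    \<comment> \<open>On \<open>B\<close> all terms of positive index are zero, so the shifted
      sequence is constant.\<close>
    have "(\<lambda>k. ?u (Suc k) y) \<longlonglongrightarrow> L y"
      using L[OF that(1)] by (rule LIMSEQ_Suc)
    with that show ?thesis by (simp add: LIMSEQ_const_iff)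
  qed
  have L_harmonic: "L y = (\<Sum>z\<in>S. p z y * L z)" if "y \<in> S" "y \<notin> B" for y
  proof (rule LIMSEQ_unique)
    show "(\<lambda>k. ?u (Suc k) y) \<longlonglongrightarrow> L y"
      using L[OF that(1)] by (rule LIMSEQ_Suc)
    show "(\<lambda>k. ?u (Suc k) y) \<longlonglongrightarrow> (\<Sum>z\<in>S. p z y * L z)"
      using that by (auto intro!: tendsto_sum tendsto_mult_left L)
  qed
  have L_nonneg: "0 \<le> L y" if "y \<in> S" for y
    using L[OF that] path_prob_nonneg[OF tm that] by (intro LIMSEQ_le_const) auto
  define m where "m = Max (L ` S)"
  have le_m: "L y \<le> m" if "y \<in> S" for y
    using that fin by (simp add: m_def)
  have "m \<le> 0"
  proof (rule ccontr)
    assume "\<not> m \<le> 0"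
    have step: "L z = m" if "transition S p y z" "L y = m" for y z
    proof -
      from that have yz: "y \<in> S" "z \<in> S" "p z y > 0"
        by (auto simp: transition_def)
      with that \<open>\<not> m \<le> 0\<close> have "y \<notin> B" using L_B by force
      \<comment> \<open>The maximum \<open>m = L y\<close> is an average of values at most
        \<open>m\<close>, so every weighted gap must vanish.\<close>
      have "(\<Sum>z\<in>S. p z y * (m - L z)) = m * (\<Sum>z\<in>S. p z y) - (\<Sum>z\<in>S. p z y * L z)"
        by (simp add: sum_distrib_left sum_subtractf algebra_simps)
      also have "\<dots> = 0"
        using L_harmonic[OF yz(1) \<open>y \<notin> B\<close>] that(2) tm yz(1)
        by (simp add: transition_matrix_def)
      finally have "\<forall>z\<in>S. p z y * (m - L z) = 0"
        using fin tm yz(1) le_m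
        by (subst (asm) sum_nonneg_eq_0_iff) (auto simp: transition_matrix_def)
      with yz show ?thesis by force
    qed
    have "m \<in> L ` S"
      using fin x by (auto simp: m_def intro: Max_in)
    then obtain y where y: "y \<in> S" "L y = m" by auto
    with reach obtain b where b: "b \<in> B" "(transition S p)\<^sup>*\<^sup>* y b" by blast
    from b(2) have "b \<in> S \<and> L b = m"
      by induction (use y step in \<open>auto simp: transition_def\<close>)
    with b(1) L_B \<open>\<not> m \<le> 0\<close> show False by force
  qed
  with le_m[OF x] L_nonneg[OF x] have "L x = 0" by simp
  with L[OF x] show ?thesis by simp
qed

text \<open>As a reflexive transitive closure, reachability can be composed: a path into
  \<open>A\<close> can be continued by one from \<open>A\<close> to \<open>B\<close>.\<close>

lemma reachable_transition:
  assumes "reachable V p A B C x"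
  shows "\<exists>y\<in>C. (transition V p)\<^sup>*\<^sup>* x y"
proof -
  from assms obtain k v where v: "v 0 = x" "v k \<in> C" "\<forall>l\<le>k. v l \<in> V"
    "\<forall>l<k. p (v (Suc l)) (v l) > 0"
    unfolding reachable_def by blast
  have "(transition V p)\<^sup>*\<^sup>* x (v l)" if "l \<le> k" for l
    using that
  proof (induction l)
    case (Suc l)
    then have "transition V p (v l) (v (Suc l))"
      using v by (simp add: transition_def)
    with Suc show ?case by (simp add: rtranclp.rtrancl_into_rtrancl)
  qed (simp add: v)
  with v show ?thesis by blast
qed

text \<open>Never hitting \<open>B\<close> entails surviving outside \<open>B\<close> up to each
  time \<open>k\<close>; the survival probability, averaged over the starting state, tends to
  zero.\<close>

lemma (in finite_markov_chain) AE_hits: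
  assumes tm: "transition_matrix S p"
    and reach: "\<And>x. x \<in> S \<Longrightarrow> \<exists>b\<in>B. (transition S p)\<^sup>*\<^sup>* x b"
  shows "AE w in M. \<exists>k. X k w \<in> B"
proof -
  let ?u = "path_prob S p (S - B) S"
  have "(\<lambda>k. \<Sum>x\<in>S. pmf \<mu> x * ?u k x) \<longlonglongrightarrow> (\<Sum>x\<in>S. pmf \<mu> x * 0)"
    by (intro tendsto_sum tendsto_mult_left survival_prob_tendsto_0[OF tm finite_states reach])
  then have lim: "(\<lambda>k. \<Sum>x\<in>S. pmf \<mu> x * ?u k x) \<longlonglongrightarrow> 0" by simp
  have "\<P>(w in M. \<forall>k. X k w \<notin> B) \<le> (\<Sum>x\<in>S. pmf \<mu> x * ?u k x)" for k
  proof -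
    have "\<P>(w in M. \<forall>k. X k w \<notin> B) \<le>
        measure M (\<Union>x\<in>S. {w \<in> space M. X 0 w = x \<and> (\<forall>j<k. X j w \<in> S - B) \<and> X k w \<in> S})"
      using X_in_states by (intro finite_measure_mono) (auto intro!: sets.finite_UN finite_states)
    also have "\<dots> \<le> (\<Sum>x\<in>S. \<P>(w in M. X 0 w = x \<and> (\<forall>j<k. X j w \<in> S - B) \<and> X k w \<in> S))"
      by (intro finite_measure_subadditive_finite) (auto intro: finite_states)
    also have "\<dots> = (\<Sum>x\<in>S. pmf \<mu> x * ?u k x)"
      using prob_path[of 0 "\<lambda>_. _" k "S - B" S] by (intro sum.cong) (simp_all add: prob_start)
    finally show ?thesis .
  qed
  with lim have "\<P>(w in M. \<forall>k. X k w \<notin> B) \<le> 0"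
    by (intro LIMSEQ_le_const) auto
  then have "\<P>(w in M. \<forall>k. X k w \<notin> B) = 0"
    by (simp add: measure_le_0_iff)
  then show ?thesis
    by (subst (asm) prob_Collect_eq_0) auto
qed

section \<open>Laws of the stopped trajectories\<close>

text \<open>Serves measurability: the stopping index becomes a least index, with a fixed default
  value on paths that never hit.\<close>

lemma the_hitting_time_conv_Least:
  "the_enat (hitting_time C x) = (if \<exists>k. x k \<in> C then LEAST k. x k \<in> C else the_enat \<infinity>)"
proof (cases "\<exists>k. x k \<in> C")
  case True
  then obtain k where "x k \<in> C" by blast
  with True show ?thesis by (simp add: hitting_time_Least)
qed (simp add: hitting_time_infinity)

text \<open>Last-exit decomposition: \<open>m\<close> is the last visit to \<open>A\<close> before
  \<open>B\<close> exactly if the path from time \<open>Suc m\<close> on stays outside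
  \<open>A \<union> B\<close> until it enters \<open>B\<close>. The case \<open>k = 0\<close> is a
  direct jump from \<open>h m\<close> into \<open>B\<close>.\<close>

lemma nonreactive_eq_iff:
  assumes V: "\<And>k. x k \<in> V" and disj: "A \<inter> B = {}"
  shows "x 0 \<in> A \<and> (\<exists>k. x k \<in> B) \<and> nonreactive A B x = map h [0..<Suc m] \<longleftrightarrow>
    h 0 \<in> A \<and> h m \<in> A \<and> (\<forall>i\<le>m. h i \<notin> B) \<and> (\<forall>i\<le>m. x i = h i) \<and>
    (\<exists>k. (\<forall>j<k. x (Suc m + j) \<in> V - (A \<union> B)) \<and> x (Suc m + k) \<in> B)"
    (is "?lhs \<longleftrightarrow> ?rhs")
proof -
  define T where "T = {l. x l \<in> A \<and> (\<forall>j\<le>l. x j \<notin> B)}"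
  have last: "last_hit A B x = Max T"
    by (simp add: last_hit_def T_def less_hitting_time_iff)
  have nr: "nonreactive A B x = map h [0..<Suc m] \<longleftrightarrow> Max T = m \<and> (\<forall>i\<le>m. x i = h i)"
  proof
    assume "nonreactive A B x = map h [0..<Suc m]"
    then have eq: "map x [0..<Suc (Max T)] = map h [0..<Suc m]"
      by (simp only: nonreactive_def last)
    then have "length (map x [0..<Suc (Max T)]) = length (map h [0..<Suc m])"
      by (rule arg_cong)
    then have "Max T = m" by simp
    with eq show "Max T = m \<and> (\<forall>i\<le>m. x i = h i)"
      by (simp only: map_eq_conv) (auto simp: less_Suc_eq_le)
  next
    assume "Max T = m \<and> (\<forall>i\<le>m. x i = h i)"
    then show "nonreactive A B x = map h [0..<Suc m]"
      by (simp only: nonreactive_def last map_eq_conv) auto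
  qed
  show ?thesis
  proof
    assume ?lhs
    then have "x 0 \<in> A" and "\<exists>k. x k \<in> B" and max: "Max T = m" and xh: "\<forall>i\<le>m. x i = h i"
      unfolding nr by auto
    define K where "K = (LEAST k. x k \<in> B)"
    have K: "x K \<in> B" "\<And>k. k < K \<Longrightarrow> x k \<notin> B"
      using LeastI_ex[OF \<open>\<exists>k. x k \<in> B\<close>] not_less_Least by (auto simp: K_def)
    \<comment> \<open>\<open>T\<close> is nonempty and bounded by the first entrance
      \<open>K\<close> into \<open>B\<close>, so its \<open>Max\<close> is genuine.\<close>
    have "0 \<in> T" using \<open>x 0 \<in> A\<close> disj by (auto simp: T_def)
    moreover have "finite T"
      using K by (auto simp: T_def finite_nat_set_iff_bounded_le intro!: exI[of _ K] leI)
    ultimately have mT: "m \<in> T" and le_m: "\<And>l. l \<in> T \<Longrightarrow> l \<le> m"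
      using Max_in[of T] Max_ge[of T] max by auto
    have "m < K" using mT K(1) by (auto simp: T_def not_le[symmetric])
    \<comment> \<open>A visit to \<open>A\<close> between \<open>m\<close> and \<open>K\<close>
      would be an element of \<open>T\<close> above \<open>m\<close>.\<close>
    have "x (Suc m + j) \<in> V - (A \<union> B)" if "j < K - Suc m" for j
    proof -
      have "\<forall>i\<le>Suc m + j. x i \<notin> B" using that K(2) by auto
      with le_m[of "Suc m + j"] V show ?thesis by (auto simp: T_def)
    qed
    moreover have "x (Suc m + (K - Suc m)) \<in> B"
      using K(1) \<open>m < K\<close> by simp
    ultimately have "\<exists>k. (\<forall>j<k. x (Suc m + j) \<in> V - (A \<union> B)) \<and> x (Suc m + k) \<in> B"
      by blast
    with mT xh \<open>x 0 \<in> A\<close> show ?rhs by (auto simp: T_def)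
  next
    assume r: ?rhs
    then obtain k where k: "\<forall>j<k. x (Suc m + j) \<in> V - (A \<union> B)" "x (Suc m + k) \<in> B"
      by blast
    \<comment> \<open>Any time after \<open>m\<close> either lies in the excursion outside
      \<open>A\<close> or is not before the entrance into \<open>B\<close>.\<close>
    have le_m: "l \<le> m" if "l \<in> T" for l
    proof (rule ccontr)
      assume "\<not> l \<le> m"
      then obtain j where j: "l = Suc m + j"
        by (metis less_eq_Suc_le nat_le_iff_add not_le)
      show False
      proof (cases "j < k")
        case True
        with k(1) that j show False by (auto simp: T_def)
      next
        case False
        then have "Suc m + k \<le> l" using j by simp
        with that k(2) show False unfolding T_def by blast
      qed
    qed
    moreover have "m \<in> T" using r by (auto simp: T_def)
    moreover have "finite T" using le_m by (auto simp: finite_nat_set_iff_bounded_le)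
    ultimately have "Max T = m" by (intro Max_eqI)
    with r k show ?lhs unfolding nr by auto
  qed
qed

text \<open>The length of the list is the hitting time of 0, which must therefore be
  \<open>Suc m\<close>. Requiring a visit to 0 rules out the default value of
  \<open>the_enat\<close> at infinity.\<close>

lemma before_end_eq_iff:
  "(\<exists>k. y k \<in> {0}) \<and> before_end y = map h [0..<Suc m] \<longleftrightarrow>
    (\<forall>i\<le>m. h i \<noteq> 0) \<and> (\<forall>i\<le>m. y i = h i) \<and> y (Suc m) = 0" (is "?lhs \<longleftrightarrow> ?rhs")
proof
  assume l: ?lhs
  then obtain t where t: "hitting_time {0} y = enat t"
    using hitting_time_finite_iff[of "{0}" y] by (cases "hitting_time {0} y") auto
  with l have eq: "map y [0..<t] = map h [0..<Suc m]"
    by (simp only: before_end_def the_enat.simps)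
  then have "length (map y [0..<t]) = length (map h [0..<Suc m])"
    by (rule arg_cong)
  then have "t = Suc m" by simp
  with eq have "\<forall>i\<le>m. y i = h i"
    by (simp only: map_eq_conv) (auto simp: less_Suc_eq_le)
  moreover have "y (Suc m) = 0" "\<forall>i\<le>m. y i \<noteq> 0"
    using t \<open>t = Suc m\<close> by (auto simp: hitting_time_eq_enat_iff less_Suc_eq_le)
  ultimately show ?rhs by auto
next
  assume r: ?rhs
  then have "hitting_time {0} y = enat (Suc m)"
    by (auto simp: hitting_time_eq_enat_iff less_Suc_eq_le)
  then have "before_end y = map y [0..<Suc m]"
    by (simp only: before_end_def the_enat.simps)
  with r show ?lhs by (auto intro!: exI[of _ "Suc m"])
qed

section \<open>Measurability and point probabilities of the stopped lists\<close>

context finite_markov_chain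
begin

lemma measurable_map_upt:
  "(\<lambda>w. map (\<lambda>k. X k w) [0..<m]) \<in> measurable M (count_space UNIV)"
proof -
  have "(\<lambda>w. map (\<lambda>k. X k w) [0..<m]) -` {l} \<inter> space M \<in> sets M" for l
  proof -
    have "(\<lambda>w. map (\<lambda>k. X k w) [0..<m]) -` {l} \<inter> space M =
        {w \<in> space M. length l = m \<and> (\<forall>i<m. X i w = l ! i)}"
      by (auto intro!: nth_equalityI)
    also have "\<dots> \<in> sets M" by measurable
    finally show ?thesis .
  qed
  then show ?thesis
    by (simp add: measurable_count_space_eq2_countable)
qed

lemma measurable_last_hit:
  "(\<lambda>w. last_hit A B (\<lambda>k. X k w)) \<in> measurable M (count_space UNIV)"
  unfolding last_hit_def less_hitting_time_iff
  by (rule measurable_Max_nat) measurable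

lemma measurable_the_hitting_time:
  "(\<lambda>w. the_enat (hitting_time C (\<lambda>k. X k w))) \<in> measurable M (count_space UNIV)"
  unfolding the_hitting_time_conv_Least
proof (rule measurable_If)
  show "(\<lambda>w. LEAST k. X k w \<in> C) \<in> measurable M (count_space UNIV)"
    by (rule measurable_Least) measurable
qed measurable

lemma measurable_nonreactive:
  "(\<lambda>w. nonreactive A B (\<lambda>k. X k w)) \<in> measurable M (count_space UNIV)"
  unfolding nonreactive_def
  by (rule measurable_compose_countable[where f = "\<lambda>m w. map (\<lambda>k. X k w) [0..<Suc m]",
      OF measurable_map_upt measurable_last_hit])

lemma measurable_before_end:
  "(\<lambda>w. before_end (\<lambda>k. X k w)) \<in> measurable M (count_space UNIV)"
  unfolding before_end_def
  by (rule measurable_compose_countable[where f = "\<lambda>m w. map (\<lambda>k. X k w) [0..<m]",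
      OF measurable_map_upt measurable_the_hitting_time])

text \<open>The hitting condition starts one step after the history, hence the average of
  \<open>q\<close> over the next state. In the application \<open>h m\<close> lies in
  \<open>A\<close>, where \<open>q\<close> itself vanishes.\<close>

lemma prob_history_then_hit:
  assumes h: "\<And>i. i \<le> m \<Longrightarrow> h i \<in> S" and disj: "D \<inter> E = {}"
    and sums: "\<And>x. x \<in> S \<Longrightarrow> (\<lambda>k. path_prob S p D E k x) sums q x"
  shows "\<P>(w in M. (\<forall>i\<le>m. X i w = h i) \<and>
      (\<exists>k. (\<forall>j<k. X (Suc m + j) w \<in> D) \<and> X (Suc m + k) w \<in> E)) =
    pmf \<mu> (h 0) * (\<Prod>i<m. p (h (Suc i)) (h i)) * (\<Sum>y\<in>S. p y (h m) * q y)"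
proof -
  let ?P = "\<lambda>w. \<exists>k. (\<forall>j<k. X (Suc m + j) w \<in> D) \<and> X (Suc m + k) w \<in> E"
  let ?H = "\<lambda>y. h(Suc m := y)"
  have "\<P>(w in M. (\<forall>i\<le>m. X i w = h i) \<and> ?P w) =
      (\<Sum>y\<in>S. \<P>(w in M. (\<forall>i\<le>Suc m. X i w = ?H y i) \<and> ?P w))"
    by (rule prob_history_extend) measurable
  also have "\<dots> = (\<Sum>y\<in>S. \<P>(w in M. \<forall>i\<le>m. X i w = h i) * p y (h m) * q y)"
  proof (rule sum.cong)
    fix y assume y: "y \<in> S"
    have "?H y i \<in> S" if "i \<le> Suc m" for i
      using h y that by (auto simp: le_Suc_eq)
    from sums_prob_hit[of "Suc m" "?H y", OF this disj]
    have "(\<lambda>k. \<P>(w in M. \<forall>i\<le>Suc m. X i w = ?H y i) * path_prob S p D E k y) sums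
        \<P>(w in M. (\<forall>i\<le>Suc m. X i w = ?H y i) \<and> ?P w)"
      by (simp only: fun_upd_same)
    moreover have "(\<lambda>k. \<P>(w in M. \<forall>i\<le>Suc m. X i w = ?H y i) * path_prob S p D E k y) sums
        (\<P>(w in M. \<forall>i\<le>Suc m. X i w = ?H y i) * q y)"
      using sums[OF y] by (rule sums_mult)
    ultimately have "\<P>(w in M. (\<forall>i\<le>Suc m. X i w = ?H y i) \<and> ?P w) =
        \<P>(w in M. \<forall>i\<le>Suc m. X i w = ?H y i) * q y"
      by (rule sums_unique2)
    then show "\<P>(w in M. (\<forall>i\<le>Suc m. X i w = ?H y i) \<and> ?P w) =
        \<P>(w in M. \<forall>i\<le>m. X i w = h i) * p y (h m) * q y"
      by (simp only: prob_history_Suc[OF y])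
  qed simp
  also have "\<dots> = \<P>(w in M. \<forall>i\<le>m. X i w = h i) * (\<Sum>y\<in>S. p y (h m) * q y)"
    by (simp add: sum_distrib_left mult.assoc)
  finally show ?thesis
    by (simp add: prob_history[OF h])
qed

text \<open>The last-exit decomposition turns the event into a history followed by a hit of
  \<open>B\<close>. The requirement that \<open>h 0\<close> lie in \<open>A\<close> is absorbed by
  the factor \<open>pmf \<mu> (h 0)\<close>, which is zero otherwise.\<close>

lemma prob_nonreactive:
  assumes disj: "A \<inter> B = {}" and "set_pmf \<mu> \<subseteq> A"
    and sums: "\<And>x. x \<in> S \<Longrightarrow> (\<lambda>k. path_prob S p (S - (A \<union> B)) B k x) sums q x"
  shows "\<P>(w in M. (X 0 w \<in> A \<and> (\<exists>k. X k w \<in> B)) \<and>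
      nonreactive A B (\<lambda>k. X k w) = map h [0..<Suc m]) =
    (if (\<forall>i\<le>m. h i \<in> S - B) \<and> h m \<in> A
     then pmf \<mu> (h 0) * (\<Prod>i<m. p (h (Suc i)) (h i)) * (\<Sum>y\<in>S. p y (h m) * q y) else 0)"
    (is "measure M ?L = ?R")
proof -
  let ?P = "\<lambda>w. \<exists>k. (\<forall>j<k. X (Suc m + j) w \<in> S - (A \<union> B)) \<and> X (Suc m + k) w \<in> B"
  have "(X 0 w \<in> A \<and> (\<exists>k. X k w \<in> B)) \<and> nonreactive A B (\<lambda>k. X k w) = map h [0..<Suc m] \<longleftrightarrow>
      h 0 \<in> A \<and> h m \<in> A \<and> (\<forall>i\<le>m. h i \<notin> B) \<and> (\<forall>i\<le>m. X i w = h i) \<and> ?P w"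
    if "w \<in> space M" for w
  proof -
    have "X k w \<in> S" for k using that by (rule X_in_states)
    from nonreactive_eq_iff[where x = "\<lambda>k. X k w" and V = S and h = h and m = m, OF this disj]
    show ?thesis by (simp only: conj_assoc)
  qed
  then have L: "?L = {w \<in> space M. h 0 \<in> A \<and> h m \<in> A \<and> (\<forall>i\<le>m. h i \<notin> B) \<and>
      (\<forall>i\<le>m. X i w = h i) \<and> ?P w}"
    by (intro Collect_cong conj_cong[OF refl])
  show ?thesis
  proof (cases "h 0 \<in> A \<and> (\<forall>i\<le>m. h i \<in> S - B) \<and> h m \<in> A")
    case True
    then have "?L = {w \<in> space M. (\<forall>i\<le>m. X i w = h i) \<and> ?P w}"
      unfolding L by auto
    moreover have "h i \<in> S" if "i \<le> m" for i
      using True that by auto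
    moreover have "(S - (A \<union> B)) \<inter> B = {}" by auto
    ultimately have "measure M ?L =
        pmf \<mu> (h 0) * (\<Prod>i<m. p (h (Suc i)) (h i)) * (\<Sum>y\<in>S. p y (h m) * q y)"
      by (simp only:) (rule prob_history_then_hit[OF _ _ sums])
    with True show ?thesis by simp
  next
    case False
    have "w \<notin> ?L" if "w \<in> space M" for w
    proof
      assume "w \<in> ?L"
      then have h: "h 0 \<in> A" "h m \<in> A" "\<forall>i\<le>m. h i \<notin> B" "\<forall>i\<le>m. X i w = h i"
        unfolding L by auto
      have "h i \<in> S - B" if "i \<le> m" for i
        using h(3,4) X_in_states[OF \<open>w \<in> space M\<close>, of i] that by simp
      with h False show False by blast
    qed
    then have "?L = {}" by blast
    moreover from False have "?R = 0"
      using assms(2) by (auto simp: pmf_eq_0_set_pmf)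
    ultimately show ?thesis by (simp only: measure_empty)
  qed
qed

lemma prob_before_end:
  assumes "0 \<in> S"
  shows "\<P>(w in M. (\<exists>k. X k w \<in> {0}) \<and> before_end (\<lambda>k. X k w) = map h [0..<Suc m]) =
    (if \<forall>i\<le>m. h i \<in> S - {0}
     then pmf \<mu> (h 0) * (\<Prod>i<m. p (h (Suc i)) (h i)) * p 0 (h m) else 0)"
    (is "measure M ?L = ?R")
proof -
  have L: "?L = {w \<in> space M. (\<forall>i\<le>m. h i \<noteq> 0) \<and> (\<forall>i\<le>m. X i w = h i) \<and> X (Suc m) w = 0}"
    by (intro Collect_cong conj_cong refl before_end_eq_iff)
  show ?thesis
  proof (cases "\<forall>i\<le>m. h i \<in> S - {0}")
    case True
    then have "?L = {w \<in> space M. (\<forall>i\<le>m. X i w = h i) \<and> X (Suc m) w = 0}"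
      unfolding L by auto
    moreover have "h i \<in> S" if "i \<le> m" for i
      using True that by auto
    ultimately show ?thesis
      using assms by (simp only: prob_step prob_history if_P[OF True])
  next
    case False
    then obtain i where i: "i \<le> m" "h i \<notin> S - {0}" by blast
    have "w \<notin> ?L" if "w \<in> space M" for w
      unfolding L using X_in_states[OF that, of i] i by auto
    then have "?L = {}" by blast
    with False show ?thesis by (simp only: measure_empty if_False)
  qed
qed

end

text \<open>Summing the point probabilities over the countably many values shows that
  \<open>P\<close> and \<open>Q\<close> have equal mass. Since \<open>P\<close> is almost sure, so
  is \<open>Q\<close>, and restricting to these events does not change the laws.\<close>

lemma distr_eqI_countable:
  fixes F :: "'m \<Rightarrow> 'a :: countable" and G :: "'n \<Rightarrow> 'a"
  assumes "prob_space M" "prob_space N"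
    and [measurable]: "F \<in> measurable M (count_space UNIV)" "G \<in> measurable N (count_space UNIV)"
      "Measurable.pred M P" "Measurable.pred N Q"
    and P: "AE w in M. P w"
    and eq: "\<And>a. \<P>(w in M. P w \<and> F w = a) = \<P>(w in N. Q w \<and> G w = a)"
  shows "AE w in N. Q w" and "distr M (count_space UNIV) F = distr N (count_space UNIV) G"
proof -
  interpret M: prob_space M by fact
  interpret N: prob_space N by fact
  have eq': "emeasure M {w \<in> space M. P w \<and> F w = a} = emeasure N {w \<in> space N. Q w \<and> G w = a}" for a
    using eq by (simp add: M.emeasure_eq_measure N.emeasure_eq_measure)
  have split_M: "{w \<in> space M. P w} = (\<Union>a. {w \<in> space M. P w \<and> F w = a})"
    and split_N: "{w \<in> space N. Q w} = (\<Union>a. {w \<in> space N. Q w \<and> G w = a})" by auto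
  have "emeasure M {w \<in> space M. P w} = emeasure N {w \<in> space N. Q w}"
    unfolding split_M split_N
    by (subst (1 2) emeasure_UN_countable) (auto simp: disjoint_family_on_def eq')
  moreover have "emeasure M {w \<in> space M. P w} = 1"
    using P by (simp add: M.emeasure_eq_measure M.prob_Collect_eq_1)
  ultimately have "\<P>(w in N. Q w) = 1"
    by (simp add: N.emeasure_eq_measure)
  then show Q: "AE w in N. Q w"
    by (simp add: N.prob_Collect_eq_1)
  show "distr M (count_space UNIV) F = distr N (count_space UNIV) G"
  proof (rule measure_eqI_countable[where A = UNIV])
    fix a
    have "emeasure (distr M (count_space UNIV) F) {a} = emeasure M {w \<in> space M. F w = a}"
      by (subst emeasure_distr) (auto intro!: arg_cong[where f = "emeasure M"])
    also have "\<dots> = emeasure M {w \<in> space M. P w \<and> F w = a}"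
      using P by (intro emeasure_eq_AE) auto
    also have "\<dots> = emeasure N {w \<in> space N. G w = a}"
      unfolding eq' using Q by (intro emeasure_eq_AE) auto
    also have "\<dots> = emeasure (distr N (count_space UNIV) G) {a}"
      by (subst emeasure_distr) (auto intro!: arg_cong[where f = "emeasure N"])
    finally show "emeasure (distr M (count_space UNIV) F) {a} = emeasure (distr N (count_space UNIV) G) {a}" .
  qed auto
qed

section \<open>The transformed chain\<close>

text \<open>Isolates the bounds, boundary values and harmonicity of the committor, so that the
  algebra of \<open>pbar\<close> proceeds without any probability space.\<close>

locale committor_function =
  fixes V A B :: "nat set" and p :: "nat \<Rightarrow> nat \<Rightarrow> real" and q :: "nat \<Rightarrow> real"
  assumes tm: "transition_matrix V p" and fin: "finite V" and zero: "0 \<notin> V"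
    and A_subset: "A \<subseteq> V" and B_subset: "B \<subseteq> V"
    and q_nonneg: "x \<in> V \<Longrightarrow> 0 \<le> q x" and q_le_1: "x \<in> V \<Longrightarrow> q x \<le> 1"
    and q_A: "x \<in> A \<Longrightarrow> q x = 0" and q_B: "x \<in> B \<Longrightarrow> q x = 1"
    and q_harmonic: "x \<in> V - (A \<union> B) \<Longrightarrow> q x = (\<Sum>y\<in>V. p y x * q y)"
begin

lemma p_nonneg: "x \<in> V \<Longrightarrow> y \<in> V \<Longrightarrow> 0 \<le> p y x"
  using tm by (simp add: transition_matrix_def)

lemma sum_p: "x \<in> V \<Longrightarrow> (\<Sum>y\<in>V. p y x) = 1"
  using tm by (simp add: transition_matrix_def)

lemma V_nonzero: "x \<in> V \<Longrightarrow> x \<noteq> 0"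
  using zero by metis

lemma A_subset_V_minus: "A \<subseteq> V_minus V q"
  using A_subset q_A by (auto simp: V_minus_def)

lemma V_minus_subset: "V_minus V q \<subseteq> V - B"
  using q_B by (auto simp: V_minus_def)

text \<open>From \<open>y\<close> the mass kept in \<open>V_minus V q\<close> is
  \<open>(1 - (\<Sum>z\<in>V. p z y * q z)) / (1 - q y)\<close>. Off \<open>A\<close> it is one by
  harmonicity; on \<open>A\<close>, where \<open>q y = 0\<close>, the missing mass is exactly the
  jump to 0.\<close>

lemma transition_matrix_pbar:
  "transition_matrix (insert 0 (V_minus V q)) (pbar V A p q)"
proof -
  let ?W = "V_minus V q"
  have W: "?W \<subseteq> V" "0 \<notin> ?W" "finite ?W"
    using zero fin by (auto simp: V_minus_def)
  have sum_W: "(\<Sum>x\<in>?W. pbar V A p q x y) = (1 - (\<Sum>z\<in>V. p z y * q z)) / (1 - q y)"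
    if y: "y \<in> ?W" for y
  proof -
    have "(\<Sum>x\<in>?W. pbar V A p q x y) = (\<Sum>x\<in>?W. p x y * (1 - q x) / (1 - q y))"
      using y W by (intro sum.cong) (auto simp: pbar_def)
    also have "\<dots> = (\<Sum>x\<in>V. p x y * (1 - q x) / (1 - q y))"
      \<comment> \<open>The added nodes have \<open>q = 1\<close>, so their terms vanish.\<close>
      using fin q_le_1 by (intro sum.mono_neutral_left) (force simp: V_minus_def)+
    also have "\<dots> = ((\<Sum>x\<in>V. p x y) - (\<Sum>x\<in>V. p x y * q x)) / (1 - q y)"
      by (simp add: sum_divide_distrib[symmetric] right_diff_distrib sum_subtractf)
    finally show ?thesis using y W sum_p by auto
  qed
  have pbar_0: "pbar V A p q 0 y = (if y \<in> A then \<Sum>z\<in>V. p z y * q z else 0)" if "y \<in> ?W" for y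
    using that W by (auto simp: pbar_def)
  have "(\<Sum>x\<in>insert 0 ?W. pbar V A p q x y) = 1" if "y \<in> insert 0 ?W" for y
  proof (cases "y = 0")
    case True
    then have "(\<Sum>x\<in>?W. pbar V A p q x y) = 0"
      using W(1) V_nonzero by (intro sum.neutral) (auto simp: pbar_def)
    with True W show ?thesis by (simp add: pbar_def)
  next
    case False
    with that have y: "y \<in> ?W" by simp
    have sum: "(\<Sum>x\<in>insert 0 ?W. pbar V A p q x y) =
        pbar V A p q 0 y + (1 - (\<Sum>z\<in>V. p z y * q z)) / (1 - q y)"
      using W y by (simp add: sum_W)
    show ?thesis
    proof (cases "y \<in> A")
      case True
      with sum y q_A show ?thesis by (simp add: pbar_0)
    next
      case False
      with y V_minus_subset have "y \<in> V - (A \<union> B)" by auto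
      with sum y False q_harmonic[of y] show ?thesis
        by (simp add: pbar_0 V_minus_def)
    qed
  qed
  moreover have "0 \<le> pbar V A p q x y" if "y \<in> insert 0 ?W" "x \<in> insert 0 ?W" for x y
    using that p_nonneg q_nonneg
    by (auto simp: pbar_def V_minus_def intro!: sum_nonneg mult_nonneg_nonneg divide_nonneg_nonneg)
  ultimately show ?thesis
    by (simp add: transition_matrix_def)
qed

text \<open>A Doob transform by \<open>1 - q\<close>: each numerator cancels the next denominator,
  and none is zero inside \<open>V_minus V q\<close>.\<close>

lemma prod_pbar:
  assumes "\<And>i. i \<le> m \<Longrightarrow> h i \<in> V_minus V q"
  shows "(\<Prod>i<m. pbar V A p q (h (Suc i)) (h i)) =
    (\<Prod>i<m. p (h (Suc i)) (h i)) * (1 - q (h m)) / (1 - q (h 0))"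
  using assms
proof (induction m)
  case 0
  from 0[of 0] show ?case by (simp add: V_minus_def)
next
  case (Suc m)
  have "h m \<noteq> 0" "h (Suc m) \<noteq> 0" "1 - q (h m) \<noteq> 0"
    using Suc.prems[of m] Suc.prems[of "Suc m"] V_nonzero by (auto simp: V_minus_def)
  with Suc show ?case by (simp add: pbar_def)
qed

text \<open>By harmonicity the value 1 is an average of values at most 1, so no successor of
  positive weight can have a smaller value.\<close>

lemma committor_1_step:
  assumes x: "x \<in> V - B" "q x = 1" and y: "y \<in> V" "p y x \<noteq> 0"
  shows "q y = 1"
proof -
  from x q_A have x': "x \<in> V - (A \<union> B)" by auto
  have "(\<Sum>z\<in>V. p z x * (1 - q z)) = (\<Sum>z\<in>V. p z x) - (\<Sum>z\<in>V. p z x * q z)"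
    by (simp add: right_diff_distrib sum_subtractf)
  also have "\<dots> = 0"
    using q_harmonic[OF x'] x sum_p by simp
  finally have "\<forall>z\<in>V. p z x * (1 - q z) = 0"
    using fin x p_nonneg q_le_1 by (subst (asm) sum_nonneg_eq_0_iff) auto
  with y show ?thesis by auto
qed

text \<open>Once \<open>q = 1\<close> holds at \<open>h i\<close>, nonzero steps outside
  \<open>B\<close> would propagate it to \<open>h m\<close>, contradicting \<open>q = 0\<close> on
  \<open>A\<close>.\<close>

lemma path_weight_eq_0:
  assumes h: "\<And>i. i \<le> m \<Longrightarrow> h i \<in> V - B" and "h m \<in> A"
    and i: "i \<le> m" "h i \<notin> V_minus V q"
  shows "(\<Prod>i<m. p (h (Suc i)) (h i)) = 0"
proof (rule ccontr)
  assume nz: "(\<Prod>i<m. p (h (Suc i)) (h i)) \<noteq> 0"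
  have "j \<le> m \<Longrightarrow> q (h j) = 1" if "i \<le> j" for j
    using that
  proof (induction j rule: dec_induct)
    case base
    with i h[of i] q_le_1[of "h i"] show ?case by (auto simp: V_minus_def)
  next
    case (step j)
    then have "j < m" "q (h j) = 1" by auto
    moreover from \<open>j < m\<close> nz have "p (h (Suc j)) (h j) \<noteq> 0" by simp
    ultimately show ?case
      using h[of j] h[of "Suc j"] committor_1_step[of "h j" "h (Suc j)"] by simp
  qed
  from this[of m] i \<open>h m \<in> A\<close> q_A show False by auto
qed

text \<open>With both ends in \<open>A\<close> the telescoped quotient is 1, and lists leaving
  \<open>V_minus V q\<close> have weight zero. Otherwise the start has no mass under
  \<open>\<mu>\<close>, or the end lies outside \<open>A\<close> and allows neither a nonreactive
  list nor a jump to 0.\<close>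

lemma path_weights_eq:
  assumes \<mu>: "set_pmf \<mu> \<subseteq> A"
  shows "(if (\<forall>i\<le>m. h i \<in> V - B) \<and> h m \<in> A
      then pmf \<mu> (h 0) * (\<Prod>i<m. p (h (Suc i)) (h i)) * (\<Sum>y\<in>V. p y (h m) * q y) else 0) =
    (if \<forall>i\<le>m. h i \<in> V_minus V q
      then pmf \<mu> (h 0) * (\<Prod>i<m. pbar V A p q (h (Suc i)) (h i)) * pbar V A p q 0 (h m) else 0)"
    (is "?l = ?r")
proof (cases "h m \<in> A \<and> h 0 \<in> A")
  case True
  then have "h m \<noteq> 0" using A_subset V_nonzero by auto
  show ?thesis
  proof (cases "\<forall>i\<le>m. h i \<in> V_minus V q")
    case W: True
    with V_minus_subset have "\<forall>i\<le>m. h i \<in> V - B" by auto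
    with W True \<open>h m \<noteq> 0\<close> show ?thesis
      by (simp add: prod_pbar q_A) (simp add: pbar_def)
  next
    case False
    then have "?l = 0"
      using path_weight_eq_0[of m h] True by auto
    then show ?thesis by (simp only: if_not_P[OF False])
  qed
next
  case False
  have "?r = 0"
  proof (cases "h m \<in> A")
    case True
    with False \<mu> have "pmf \<mu> (h 0) = 0" by (auto simp: pmf_eq_0_set_pmf)
    then show ?thesis by simp
  next
    case False
    \<comment> \<open>Nodes of \<open>V_minus V q\<close> differ from 0, so the absorbing branch of
      \<open>pbar\<close>, with value 1, cannot apply.\<close>
    then show ?thesis using zero by (auto simp: pbar_def V_minus_def)
  qed
  moreover have "?l = 0"
    using False \<mu> by (auto simp: pmf_eq_0_set_pmf)
  ultimately show ?thesis by simp
qed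

end

text \<open>Both \<open>A\<close> and \<open>B\<close> lie outside the set where the path must stay,
  so the series reduces there to \<open>indicator B\<close>; on that set first-step analysis gives
  harmonicity.\<close>

lemma committor_functionI:
  assumes tm: "transition_matrix V p" and fin: "finite V" and "0 \<notin> V"
    and sub: "A \<subseteq> V" "B \<subseteq> V" and disj: "A \<inter> B = {}"
    and sums: "\<And>x. x \<in> V \<Longrightarrow> (\<lambda>k. path_prob V p (V - (A \<union> B)) B k x) sums q x"
    and bounds: "\<And>x. x \<in> V \<Longrightarrow> 0 \<le> q x" "\<And>x. x \<in> V \<Longrightarrow> q x \<le> 1"
  shows "committor_function V A B p q"
proof
  show "q x = 0" if "x \<in> A" for x
  proof -
    have "x \<in> V" "x \<notin> V - (A \<union> B)" "x \<notin> B" using that sub disj by auto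
    then show ?thesis using hitting_prob_outside[OF sums, of x] by simp
  qed
  show "q x = 1" if "x \<in> B" for x
    using hitting_prob_outside[OF sums, of x] sub that by (auto simp: indicator_def)
  show "q x = (\<Sum>y\<in>V. p y x * q y)" if "x \<in> V - (A \<union> B)" for x
    using hitting_prob_harmonic[OF sums, of x] that by auto
qed (use assms in auto)

section \<open>Comparison of the laws of the two random lists\<close>

theorem proposition2:
  fixes n :: nat
    and V A B :: "nat set"
    and p :: "nat \<Rightarrow> nat \<Rightarrow> real"
    and \<mu> :: "nat pmf"
    and K :: "nat \<Rightarrow> 'k measure" and Z :: "nat \<Rightarrow> nat \<Rightarrow> 'k \<Rightarrow> nat"
    and q :: "nat \<Rightarrow> real"
    and M :: "'m measure" and X :: "nat \<Rightarrow> 'm \<Rightarrow> nat"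
    and N :: "'l measure" and Y :: "nat \<Rightarrow> 'l \<Rightarrow> nat"
  assumes "n > 1" and V: "V = {1..n}"
    and "transition_matrix V p"
    and "A \<subseteq> V" and "B \<subseteq> V" and "A \<inter> B = {}" and "A \<noteq> {}" and "B \<noteq> {}"
    and "V - (A \<union> B) \<noteq> {}"
    and "\<And>x. x \<in> V - (A \<union> B) \<Longrightarrow> reachable V p A B A x \<or> reachable V p A B B x"
    and "\<And>x. x \<in> A \<Longrightarrow> reachable V p A B B x"
    and "set_pmf \<mu> \<subseteq> A"
    and "\<And>x. x \<in> V \<Longrightarrow> markov_chain (K x) V (return_pmf x) p (Z x)"
    and q: "\<And>x. x \<in> V \<Longrightarrow> q x = committor K Z A B x"
    and "markov_chain M V \<mu> p X"
    and "markov_chain N (insert 0 (V_minus V q)) \<mu> (pbar V A p q) Y"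
  shows "A \<subseteq> V_minus V q \<and>
    transition_matrix (insert 0 (V_minus V q)) (pbar V A p q) \<and>
    (AE w in M. hitting_time B (\<lambda>k. X k w) < \<infinity>) \<and>
    (AE w in N. hitting_time {0} (\<lambda>k. Y k w) < \<infinity>) \<and>
    distr M (count_space UNIV) (\<lambda>w. nonreactive A B (\<lambda>k. X k w)) =
    distr N (count_space UNIV) (\<lambda>w. before_end (\<lambda>k. Y k w))"
proof -
  note tm = assms(3) and disj = assms(6) and reach_C = assms(10) and reach_A = assms(11)
    and \<mu> = assms(12)
  have fin: "finite V" and zero: "0 \<notin> V"
    by (auto simp: V)
  interpret X: finite_markov_chain M V \<mu> p X
    by standard (use assms fin in auto)
  interpret Y: finite_markov_chain N "insert 0 (V_minus V q)" \<mu> "pbar V A p q" Y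
    by standard (use assms fin in \<open>auto simp: V_minus_def\<close>)
  have Z: "finite_markov_chain (K x) V (return_pmf x) p (Z x)" if "x \<in> V" for x
    by standard (use assms that fin in auto)
  have sums: "(\<lambda>k. path_prob V p (V - (A \<union> B)) B k x) sums q x" if "x \<in> V" for x
    using finite_markov_chain.committor_sums[OF Z refl that disj] that
    by (simp add: q committor_def)
  interpret committor_function V A B p q
  proof (rule committor_functionI)
    show "q x \<le> 1" if "x \<in> V" for x
    proof -
      interpret finite_markov_chain "K x" V "return_pmf x" p "Z x"
        using that by (rule Z)
      show ?thesis using that by (simp add: q committor_def)
    qed
  qed (use assms fin zero sums in \<open>auto simp: committor_def\<close>)

  have reach: "\<exists>b\<in>B. (transition V p)\<^sup>*\<^sup>* x b" if x: "x \<in> V" for x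
  proof -
    have from_A: "\<exists>b\<in>B. (transition V p)\<^sup>*\<^sup>* a b" if "a \<in> A" for a
      using reachable_transition[OF reach_A[OF that]] .
    consider "x \<in> A" | "x \<in> B" | "x \<in> V - (A \<union> B)" using x by auto
    then show ?thesis
    proof cases
      \<comment> \<open>If only \<open>A\<close> is reachable, the path is continued from its
        endpoint in \<open>A\<close> to \<open>B\<close>.\<close>
      case 3
      from reach_C[OF this] show ?thesis
        using from_A by (blast dest: reachable_transition intro: rtranclp_trans)
    qed (use from_A in auto)
  qed
  have hits_B: "AE w in M. \<exists>k. X k w \<in> B"
    by (rule X.AE_hits[OF tm reach])
  \<comment> \<open>\<open>V - A\<close> is finite, so its null starting states can be discarded all
    at once.\<close>
  have "\<P>(w in M. X 0 w = s) = 0" if "s \<in> V - A" for s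
    using that \<mu> by (auto simp: X.prob_start pmf_eq_0_set_pmf)
  then have "AE w in M. \<forall>s\<in>V - A. X 0 w \<noteq> s"
    using fin by (intro AE_finite_allI) (auto simp: X.prob_Collect_eq_0)
  with AE_space have starts_A: "AE w in M. X 0 w \<in> A"
    by eventually_elim (use X.X_in_states in auto)
  have good: "AE w in M. X 0 w \<in> A \<and> (\<exists>k. X k w \<in> B)"
    using starts_A hits_B by eventually_elim simp

  have laws: "\<P>(w in M. (X 0 w \<in> A \<and> (\<exists>k. X k w \<in> B)) \<and> nonreactive A B (\<lambda>k. X k w) = l) =
      \<P>(w in N. (\<exists>k. Y k w \<in> {0}) \<and> before_end (\<lambda>k. Y k w) = l)" for l
  proof (cases l)
    case Nil
    \<comment> \<open>A nonreactive list is never empty, and \<open>before_end\<close> is empty on a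
      path reaching 0 only if the path starts there, which \<open>\<mu>\<close> excludes.\<close>
    have "\<P>(w in N. (\<exists>k. Y k w \<in> {0}) \<and> before_end (\<lambda>k. Y k w) = []) \<le> \<P>(w in N. Y 0 w = 0)"
      by (intro Y.finite_measure_mono) (auto simp: before_end_def hitting_time_Least,
        metis (mono_tags, lifting) LeastI)
    also have "\<dots> = 0"
      using \<mu> A_subset zero by (subst Y.prob_start) (auto simp: pmf_eq_0_set_pmf)
    finally have "\<P>(w in N. (\<exists>k. Y k w \<in> {0}) \<and> before_end (\<lambda>k. Y k w) = []) = 0"
      by (simp add: measure_le_0_iff)
    with Nil show ?thesis by (simp add: nonreactive_def)
  next
    case (Cons a l')
    \<comment> \<open>With \<open>m = length l'\<close> the index range up to \<open>Suc m\<close>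
      enumerates all of \<open>l\<close>.\<close>
    then have l: "l = map (nth l) [0..<Suc (length l')]"
      using map_nth[of l] by simp
    have "insert 0 (V_minus V q) - {0} = V_minus V q"
      using zero by (auto simp: V_minus_def)
    then show ?thesis
      using X.prob_nonreactive[OF disj \<mu> sums, where h = "nth l" and m = "length l'", folded l]
        Y.prob_before_end[where h = "nth l" and m = "length l'", folded l]
        path_weights_eq[OF \<mu>, where h = "nth l" and m = "length l'"]
      by (simp only: insertI1)
  qed
  have good_pred: "Measurable.pred M (\<lambda>w. X 0 w \<in> A \<and> (\<exists>k. X k w \<in> B))"
    by measurable
  have end_pred: "Measurable.pred N (\<lambda>w. \<exists>k. Y k w \<in> C)" for C
    by measurable
  \<comment> \<open>As \<open>good\<close> has full mass, equality of the point probabilities gives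
    both the almost sure absorption of \<open>Y\<close> and the equality of laws.\<close>
  note laws_eq = distr_eqI_countable[OF X.prob_space_axioms Y.prob_space_axioms
      X.measurable_nonreactive Y.measurable_before_end good_pred end_pred good laws]
  show ?thesis
    using A_subset_V_minus transition_matrix_pbar hits_B laws_eq
    by (simp only: hitting_time_finite_iff simp_thms)
qed

end
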